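(* Let $X$ be a non-empty totally disconnected compact metric space and $h\colon X\to X$ a homeomorphism. Let $(F,D)$ denote the $h$-diagram associated to $(X,h)$ with respect to an $h$-refined sequence of partitions of $X$. Then $(X,h)$ is minimal if and only if every infinite blue path $\gamma$ in $F$ satisfies property (EM).
   Context: Partitions. A partition of $X$ is a finite collection of non-empty, pairwise disjoint clopen subsets of $X$ whose union is $X$. A partition $\mathcal P_2$ is finer than $\mathcal P_1$, written $\mathcal P_2\precsim\mathcal P_1$, if every element of $\mathcal P_2$ is contained in an element of $\mathcal P_1$. The wedge $\mathcal P\wedge\mathcal Q$ is the partition of all non-empty intersections $Z\cap Z'$ with $Z\in\mathcal P$, $Z'\in\mathcal Q$. For a partition $\mathcal P$, $h^{\pm1}(\mathcal P)=\{h^{\pm1}(Z)\mid Z\in\mathcal P\}$. A sequence of partitions $\{\mathcal P_n\}_{n\ge0}$ of $X$ is $h$-refined if: (a) $\mathcal P_{n+1}\precsim\mathcal P_n$ for all $n\ge0$; (b) $\bigcup_{n\ge0}\mathcal P_n$ is a basis for the topology of $X$; (c) $\max\{\operatorname{diam}(Z)\mid Z\in\mathcal P_n\}\to0$ as $n\to\infty$; and (d) $\mathcal P_{n+1}\precsim h(\mathcal P_n)\wedge h^{-1}(\mathcal P_n)$ for all $n\ge0$. The $h$-diagram. Given an $h$-refined sequence $\{\mathcal P_n\}_{n\ge0}$, the associated $h$-diagram $(F,D)$ is the following directed graph $F$ with edges colored blue or red (the coloring encodes the separation $D$). The vertex set is $F^0=\bigsqcup_{n\ge0}F^{0,n}$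 with $F^{0,n}=\mathcal P_n$ (the same subset of $X$ occurring in different levels gives different vertices). The edge set $F^1$ consists of the following edges, for every $n\ge0$, $Z\in\mathcal P_n$ and $Z'\in\mathcal P_{n+1}$: one blue edge $e(Z',Z)$ with source $Z'$ and range $Z$ whenever $Z'\subseteq Z$; and one red edge $f(Z',Z)$ with source $Z'$ and range $Z$ whenever $Z'\subseteq h^{(-1)^n}(Z)$ (i.e. $Z'\subseteq h(Z)$ if $n$ is even, $Z'\subseteq h^{-1}(Z)$ if $n$ is odd). The separation is $D=\bigsqcup_{Z\in F^0}D_Z$, where $D_Z=\{B_Z,R_Z\}$ with $B_Z$ (resp. $R_Z$) the set of blue (resp. red) edges with range $Z$. Paths. A finite path is a sequence of edges $\mu=g_0g_1\cdots g_n$ with $s(g_i)=r(g_{i+1})$; its range is $r(\mu)=r(g_0)$ and its source is $s(\mu)=s(g_n)$. Vertices $v$ are paths of length zero with $r(v)=s(v)=v$. An infinite path is an infinite sequence $g_0g_1\cdots$ of edges with $s(g_i)=r(g_{i+1})$ for all $i\ge0$; it is blue if all its edges are blue. A vertex $w$ is connected to a vertex $v$ if there is a finite path $\mu$ (edges of any colors) with $s(\mu)=w$ and $r(\mu)=v$. Property (EM). An infinite blue path $\gamma=e_0e_1\cdots$ satisfies property (EM) if for every $i\ge0$ there exists an integer $n_i\ge0$ such that every vertex $v\in F^{0,n_i}$ is connected to $r(e_i)$. Minimality. A minimal set for $(X,h)$ is a closed, non-empty subset $Z\subseteq X$ with $h(Z)=Z$ such that any closed, non-empty $Z'\subseteq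 Z$ with $h(Z')=Z'$ equals $Z$. $(X,h)$ is essentially minimal if there is a unique minimal set $Y$; if moreover $Y=X$, then $(X,h)$ is minimal. *)

theory Defs
  imports "HOL-Analysis.Analysis" "Graph_Theory.Digraph"
begin

text \<open>
  The space is a subset \<open>X\<close> of a metric space with the subspace topology \<open>top_of_set X\<close>.
  The map \<open>h\<close> matters only on \<open>X\<close>, and the image of \<open>Z \<subseteq> X\<close> under the inverse of \<open>h\<close> on \<open>X\<close>
  is written as \<open>X \<inter> h -` Z\<close>.
\<close>

definition totally_disconnected :: "'a::topological_space set \<Rightarrow> bool" where
  "totally_disconnected X \<longleftrightarrow> (\<forall>S. S \<subseteq> X \<and> connected S \<longrightarrow> (\<exists>x. S \<subseteq> {x}))"

definition topology_basis :: "'a topology \<Rightarrow> 'a set set \<Rightarrow> bool" where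
  "topology_basis T \<B> \<longleftrightarrow>
     (\<forall>B\<in>\<B>. openin T B) \<and> (\<forall>U. openin T U \<longrightarrow> (\<exists>\<U>. \<U> \<subseteq> \<B> \<and> \<Union>\<U> = U))"


subsection \<open>Minimality\<close>

definition minimal_set :: "'a::topological_space set \<Rightarrow> ('a \<Rightarrow> 'a) \<Rightarrow> 'a set \<Rightarrow> bool" where
  "minimal_set X h Z \<longleftrightarrow>
     closedin (top_of_set X) Z \<and> Z \<noteq> {} \<and> h ` Z = Z \<and>
     (\<forall>Z'. closedin (top_of_set X) Z' \<and> Z' \<noteq> {} \<and> Z' \<subseteq> Z \<and> h ` Z' = Z' \<longrightarrow> Z' = Z)"

definition essentially_minimal :: "'a::topological_space set \<Rightarrow> ('a \<Rightarrow> 'a) \<Rightarrow> bool" where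
  "essentially_minimal X h \<longleftrightarrow> (\<exists>!Y. minimal_set X h Y)"

definition minimal_system :: "'a::topological_space set \<Rightarrow> ('a \<Rightarrow> 'a) \<Rightarrow> bool" where
  "minimal_system X h \<longleftrightarrow> essentially_minimal X h \<and> minimal_set X h X"


subsection \<open>Refined sequences of partitions\<close>

definition clopen_partition :: "'a::topological_space set \<Rightarrow> 'a set set \<Rightarrow> bool" where
  "clopen_partition X P \<longleftrightarrow>
     finite P \<and> partition_on X P \<and>
     (\<forall>Z\<in>P. openin (top_of_set X) Z \<and> closedin (top_of_set X) Z)"

definition wedge :: "'a set set \<Rightarrow> 'a set set \<Rightarrow> 'a set set" where
  "wedge P Q = {Z \<inter> Z' | Z Z'. Z \<in> P \<and> Z' \<in> Q \<and> Z \<inter> Z' \<noteq> {}}"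

definition h_refined ::
    "'a::metric_space set \<Rightarrow> ('a \<Rightarrow> 'a) \<Rightarrow> (nat \<Rightarrow> 'a set set) \<Rightarrow> bool" where
  "h_refined X h \<P> \<longleftrightarrow>
     (\<forall>n. clopen_partition X (\<P> n)) \<and>
     (\<forall>n. refines X (\<P> (Suc n)) (\<P> n)) \<and>
     topology_basis (top_of_set X) (\<Union>n. \<P> n) \<and>
     (\<lambda>n. Max (diameter ` \<P> n)) \<longlonglongrightarrow> 0 \<and>
     (\<forall>n. refines X (\<P> (Suc n)) (wedge ((`) h ` \<P> n) ((\<lambda>Z. X \<inter> h -` Z) ` \<P> n)))"


subsection \<open>Leveled graphs with blue and red edges\<close>

text \<open>The source and the range of an edge are its \<^const>\<open>tail\<close> and its \<^const>\<open>head\<close>.\<close>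

datatype edge_color = Blue | Red

record ('v, 'e) colored_diagram = "('v, 'e) pre_digraph" +
  level :: "nat \<Rightarrow> 'v set"
  color :: "'e \<Rightarrow> edge_color"

definition color_separation :: "('v, 'e) colored_diagram \<Rightarrow> 'v \<Rightarrow> 'e set set" where
  "color_separation F v =
     {{e \<in> arcs F. head F e = v \<and> color F e = Blue}, {e \<in> arcs F. head F e = v \<and> color F e = Red}}"

text \<open>
  Paths are read from the range to the source, against the direction of the edges:
  \<open>finite_path F v \<mu> w\<close> says that \<open>\<mu>\<close> is a path with range \<open>v\<close> and source \<open>w\<close>.
  The empty list stands for the path of length zero at the vertex \<open>v = w\<close>.
\<close>

definition finite_path :: "('v, 'e) colored_diagram \<Rightarrow> 'v \<Rightarrow> 'e list \<Rightarrow> 'v \<Rightarrow> bool" where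
  "finite_path F v \<mu> w \<longleftrightarrow>
     v \<in> verts F \<and> w \<in> verts F \<and> set \<mu> \<subseteq> arcs F \<and>
     (\<forall>i. Suc i < length \<mu> \<longrightarrow> tail F (\<mu> ! i) = head F (\<mu> ! Suc i)) \<and>
     (if \<mu> = [] then v = w else head F (hd \<mu>) = v \<and> tail F (last \<mu>) = w)"

definition connected_to :: "('v, 'e) colored_diagram \<Rightarrow> 'v \<Rightarrow> 'v \<Rightarrow> bool" where
  "connected_to F w v \<longleftrightarrow> (\<exists>\<mu>. finite_path F v \<mu> w)"

definition infinite_path :: "('v, 'e) colored_diagram \<Rightarrow> (nat \<Rightarrow> 'e) \<Rightarrow> bool" where
  "infinite_path F \<gamma> \<longleftrightarrow>
     (\<forall>i. \<gamma> i \<in> arcs F) \<and> (\<forall>i. tail F (\<gamma> i) = head F (\<gamma> (Suc i)))"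

definition infinite_blue_path :: "('v, 'e) colored_diagram \<Rightarrow> (nat \<Rightarrow> 'e) \<Rightarrow> bool" where
  "infinite_blue_path F \<gamma> \<longleftrightarrow> infinite_path F \<gamma> \<and> (\<forall>i. color F (\<gamma> i) = Blue)"

definition property_EM :: "('v, 'e) colored_diagram \<Rightarrow> (nat \<Rightarrow> 'e) \<Rightarrow> bool" where
  "property_EM F \<gamma> \<longleftrightarrow> (\<forall>i. \<exists>n. \<forall>v\<in>level F n. connected_to F v (head F (\<gamma> i)))"


subsection \<open>The diagram of a refined sequence\<close>

text \<open>
  A vertex is a pair \<open>(n, Z)\<close> with \<open>Z \<in> \<P> n\<close>, so that equal sets at different levels stay apart.
  An edge is a triple consisting of its color, source and range.
\<close>

type_synonym 'a diagram_vertex = "nat \<times> 'a set"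
type_synonym 'a diagram_edge = "edge_color \<times> 'a diagram_vertex \<times> 'a diagram_vertex"

definition h_diagram_graph ::
    "'a set \<Rightarrow> ('a \<Rightarrow> 'a) \<Rightarrow> (nat \<Rightarrow> 'a set set) \<Rightarrow>
     ('a diagram_vertex, 'a diagram_edge) colored_diagram" where
  "h_diagram_graph X h \<P> =
     \<lparr> verts = (\<Union>n. {n} \<times> \<P> n),
       arcs =
         {(Blue, (Suc n, Z'), (n, Z)) | n Z Z'. Z \<in> \<P> n \<and> Z' \<in> \<P> (Suc n) \<and> Z' \<subseteq> Z} \<union>
         {(Red, (Suc n, Z'), (n, Z)) | n Z Z'. Z \<in> \<P> n \<and> Z' \<in> \<P> (Suc n) \<and>
            Z' \<subseteq> (if even n then h ` Z else X \<inter> h -` Z)},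
       tail = (\<lambda>(c, s, r). s),
       head = (\<lambda>(c, s, r). r),
       level = (\<lambda>n. {n} \<times> \<P> n),
       color = (\<lambda>(c, s, r). c) \<rparr>"

definition h_diagram ::
    "'a set \<Rightarrow> ('a \<Rightarrow> 'a) \<Rightarrow> (nat \<Rightarrow> 'a set set) \<Rightarrow>
     ('a diagram_vertex, 'a diagram_edge) colored_diagram \<times>
     ('a diagram_vertex \<Rightarrow> 'a diagram_edge set set)" where
  "h_diagram X h \<P> = (h_diagram_graph X h \<P>, color_separation (h_diagram_graph X h \<P>))"

end

theory Submission
  imports Defs
begin

text \<open>
  For a cell \<open>Z\<close> of level \<open>n\<close>, let \<open>U m\<close> be the union of the cells of level \<open>m\<close> that are connected
  to \<open>Z\<close>. The sets \<open>U m\<close> increase along blue edges, and since the red edges alternately encode \<open>h\<close> and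
  its inverse, both \<open>h\<close> and its inverse map \<open>U m\<close> into \<open>U (m + 2)\<close>. Hence the union of all \<open>U m\<close> is
  open and invariant: it is \<open>X\<close> if the system is minimal, and then \<open>U m = X\<close> for some \<open>m\<close> by compactness.
  Conversely, an invariant set meeting the source of an edge meets its range, so by (EM) every
  non-empty closed invariant set meets every cell.
\<close>

section \<open>Refinement of partitions and minimal sets\<close>

lemma refines_subset:
  assumes "refines X P Q" "A \<in> P" "B \<in> Q" "x \<in> A" "x \<in> B"
  shows "A \<subseteq> B"
proof -
  obtain B' where B': "B' \<in> Q" "A \<subseteq> B'"
    using assms(1,2) unfolding refines_def by blast
  have "partition_on X Q"
    using assms(1) unfolding refines_def by blast
  then have "B' = B"
    using B' assms(3-5) unfolding partition_on_def disjoint_def by blast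
  with B' show ?thesis by simp
qed

lemma minimal_system_iff:
  assumes "X \<noteq> {}" "h ` X = X"
  shows "minimal_system X h \<longleftrightarrow>
    (\<forall>C. closedin (top_of_set X) C \<and> C \<noteq> {} \<and> h ` C = C \<longrightarrow> C = X)" (is "_ \<longleftrightarrow> ?R")
proof
  assume "minimal_system X h"
  then show ?R
    unfolding minimal_system_def minimal_set_def using closedin_imp_subset by metis
next
  assume R: ?R
  then have "minimal_set X h X"
    using assms by (auto simp: minimal_set_def)
  moreover have "Y = X" if "minimal_set X h Y" for Y
    using that R by (auto simp: minimal_set_def)
  ultimately show "minimal_system X h"
    unfolding minimal_system_def essentially_minimal_def by blast
qed

section \<open>Paths in a colored diagram\<close>

lemma connected_to_refl: "v \<in> verts F \<Longrightarrow> connected_to F v v"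
  unfolding connected_to_def finite_path_def by (rule exI[of _ "[]"]) simp

text \<open>Lists run from range to source, so a path grows at its source by appending
  \<open>e\<close>; the only new joint is the one between \<open>last \<mu>\<close> and
  \<open>e\<close>.\<close>

lemma connected_to_step:
  assumes "connected_to F (head F e) v" "e \<in> arcs F" "tail F e \<in> verts F"
  shows "connected_to F (tail F e) v"
proof -
  obtain \<mu> where \<mu>: "finite_path F v \<mu> (head F e)"
    using assms(1) unfolding connected_to_def by blast
  have "tail F ((\<mu> @ [e]) ! i) = head F ((\<mu> @ [e]) ! Suc i)" if "Suc i < length (\<mu> @ [e])" for i
  proof (cases "Suc i < length \<mu>")
    case True
    then show ?thesis using \<mu> by (simp add: finite_path_def nth_append)
  next
    case False
    then have i: "Suc i = length \<mu>" using that by simp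
    then have "\<mu> \<noteq> []" by auto
    then have "\<mu> ! i = last \<mu>"
      using i by (simp add: last_conv_nth flip: i)
    then show ?thesis
      using \<mu> i \<open>\<mu> \<noteq> []\<close> by (simp add: finite_path_def nth_append)
  qed
  then have "finite_path F v (\<mu> @ [e]) (tail F e)"
    using \<mu> assms(2,3) by (auto simp: finite_path_def split: if_splits)
  then show ?thesis unfolding connected_to_def by blast
qed

lemma finite_path_backward_invariant:
  assumes "finite_path F v \<mu> w" "Q w"
    and step: "\<And>e. e \<in> arcs F \<Longrightarrow> Q (tail F e) \<Longrightarrow> Q (head F e)"
  shows "Q v"
proof (cases "\<mu> = []")
  case True
  then show ?thesis using assms(1,2) by (simp add: finite_path_def)
next
  case False
  have arcs: "\<mu> ! i \<in> arcs F" if "i < length \<mu>" for i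
    using assms(1) that nth_mem unfolding finite_path_def by blast
  \<comment> \<open>The induction runs downwards from the last edge, whose source is
    \<open>w\<close>, to the first, whose range is \<open>v\<close>: the range of edge
    \<open>Suc i\<close> is the source of edge \<open>i\<close>.\<close>
  have "Q (head F (\<mu> ! 0))"
  proof (rule inc_induct[of 0 "length \<mu> - 1" "\<lambda>i. Q (head F (\<mu> ! i))"])
    show "Q (head F (\<mu> ! (length \<mu> - 1)))"
      using assms(1,2) False by (intro step arcs) (simp_all add: finite_path_def last_conv_nth)
    show "Q (head F (\<mu> ! i))" if "i < length \<mu> - 1" "Q (head F (\<mu> ! Suc i))" for i
      using assms(1) that by (intro step arcs) (simp_all add: finite_path_def)
  qed simp
  then show ?thesis
    using assms(1) False by (simp add: finite_path_def hd_conv_nth)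
qed

lemma connected_to_backward_invariant:
  assumes "connected_to F w v" "Q w"
    and "\<And>e. e \<in> arcs F \<Longrightarrow> Q (tail F e) \<Longrightarrow> Q (head F e)"
  shows "Q v"
  using assms finite_path_backward_invariant unfolding connected_to_def by metis

section \<open>Cells of a refined sequence\<close>

locale refined_system =
  fixes X :: "'a::metric_space set" and h :: "'a \<Rightarrow> 'a" and \<P> :: "nat \<Rightarrow> 'a set set"
  assumes compact: "compact X"
    and bij: "bij_betw h X X"
    and refined: "h_refined X h \<P>"
begin

abbreviation F :: "('a diagram_vertex, 'a diagram_edge) colored_diagram" where
  "F \<equiv> h_diagram_graph X h \<P>"

lemma level_diagram: "level F n = {n} \<times> \<P> n"
  by (simp add: h_diagram_graph_def)

lemma surj_on: "h ` X = X" and inj_on: "inj_on h X"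
  using bij by (auto simp: bij_betw_def)

lemma cell_subset: "Z \<in> \<P> n \<Longrightarrow> Z \<subseteq> X"
  and cell_nonempty: "Z \<in> \<P> n \<Longrightarrow> Z \<noteq> {}"
  and cell_open: "Z \<in> \<P> n \<Longrightarrow> openin (top_of_set X) Z"
  and cell_unique: "Z \<in> \<P> n \<Longrightarrow> Z' \<in> \<P> n \<Longrightarrow> x \<in> Z \<Longrightarrow> x \<in> Z' \<Longrightarrow> Z = Z'"
  using refined
  unfolding h_refined_def clopen_partition_def partition_on_def disjoint_def by blast+

lemma cell_exists:
  assumes "x \<in> X"
  obtains Z where "Z \<in> \<P> n" "x \<in> Z"
  using refined assms
  unfolding h_refined_def clopen_partition_def partition_on_def by blast

lemma cell_subset_cell:
  "Z' \<in> \<P> (Suc n) \<Longrightarrow> Z \<in> \<P> n \<Longrightarrow> x \<in> Z' \<Longrightarrow> x \<in> Z \<Longrightarrow> Z' \<subseteq> Z"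
  using refined refines_subset unfolding h_refined_def by metis

lemma cell_subset_wedge:
  assumes "Z' \<in> \<P> (Suc n)"
  obtains Z1 Z2 where "Z1 \<in> \<P> n" "Z2 \<in> \<P> n" "Z' \<subseteq> h ` Z1" "Z' \<subseteq> X \<inter> h -` Z2"
proof -
  have "refines X (\<P> (Suc n)) (wedge ((`) h ` \<P> n) ((\<lambda>Z. X \<inter> h -` Z) ` \<P> n))"
    using refined unfolding h_refined_def by blast
  then obtain W where "W \<in> wedge ((`) h ` \<P> n) ((\<lambda>Z. X \<inter> h -` Z) ` \<P> n)" "Z' \<subseteq> W"
    using assms unfolding refines_def by blast
  then show ?thesis
    unfolding wedge_def by (auto intro: that)
qed

text \<open>Condition (d) puts \<open>Z'\<close> inside the image of some cell \<open>Z1\<close>.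
  Injectivity of \<open>h\<close> on \<open>X\<close> places \<open>x\<close> in \<open>Z1\<close>,
  so disjointness gives \<open>Z1 = Z\<close>. Thus one point decides whether a red edge exists at
  an even level.\<close>

lemma cell_subset_image:
  assumes "Z' \<in> \<P> (Suc n)" "Z \<in> \<P> n" "x \<in> Z" "h x \<in> Z'"
  shows "Z' \<subseteq> h ` Z"
proof -
  obtain Z1 where Z1: "Z1 \<in> \<P> n" "Z' \<subseteq> h ` Z1"
    using assms(1) by (rule cell_subset_wedge)
  then obtain y where "y \<in> Z1" "h y = h x"
    using assms(4) by force
  then have "x \<in> Z1"
    using Z1(1) assms(2,3) cell_subset inj_on by (metis inj_onD subsetD)
  then show ?thesis
    using Z1 assms(2,3) cell_unique by blast
qed

lemma cell_subset_vimage: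
  assumes "Z' \<in> \<P> (Suc n)" "Z \<in> \<P> n" "x \<in> Z'" "h x \<in> Z"
  shows "Z' \<subseteq> X \<inter> h -` Z"
proof -
  obtain Z2 where Z2: "Z2 \<in> \<P> n" "Z' \<subseteq> X \<inter> h -` Z2"
    using assms(1) by (rule cell_subset_wedge)
  then have "Z2 = Z"
    using assms(2-4) cell_unique by blast
  with Z2 show ?thesis by simp
qed

section \<open>Growth of the region connected to a vertex\<close>

lemma connected_to_blue:
  assumes "connected_to F (n, Z) v" "Z \<in> \<P> n" "Z' \<in> \<P> (Suc n)" "Z' \<subseteq> Z"
  shows "connected_to F (Suc n, Z') v"
  using connected_to_step[of F "(Blue, (Suc n, Z'), (n, Z))" v] assms
  by (simp add: h_diagram_graph_def)

lemma connected_to_red: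
  assumes "connected_to F (n, Z) v" "Z \<in> \<P> n" "Z' \<in> \<P> (Suc n)"
    and "Z' \<subseteq> (if even n then h ` Z else X \<inter> h -` Z)"
  shows "connected_to F (Suc n, Z') v"
  using connected_to_step[of F "(Red, (Suc n, Z'), (n, Z))" v] assms
  by (simp add: h_diagram_graph_def)

text \<open>For \<open>v = (n, Z)\<close> this is \<open>U m\<close>. Edges change the level by one,
  so it is empty for \<open>m < n\<close>, and for a vertex \<open>v\<close> it equals
  \<open>Z\<close> at \<open>m = n\<close>.\<close>

definition reach :: "'a diagram_vertex \<Rightarrow> nat \<Rightarrow> 'a set" where
  "reach v m = \<Union>{W \<in> \<P> m. connected_to F (m, W) v}"

lemma reach_subset: "reach v m \<subseteq> X"
  using cell_subset unfolding reach_def by blast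

lemma open_reach: "openin (top_of_set X) (reach v m)"
  unfolding reach_def by (rule openin_Union) (use cell_open in blast)

lemma reach_Suc: "reach v m \<subseteq> reach v (Suc m)"
proof
  fix x assume "x \<in> reach v m"
  then obtain W where W: "W \<in> \<P> m" "connected_to F (m, W) v" "x \<in> W"
    unfolding reach_def by blast
  obtain W' where W': "W' \<in> \<P> (Suc m)" "x \<in> W'"
    using W cell_subset cell_exists by (metis subsetD)
  have "connected_to F (Suc m, W') v"
    using W W' cell_subset_cell connected_to_blue by metis
  then show "x \<in> reach v (Suc m)"
    using W' unfolding reach_def by blast
qed

lemma reach_mono: "m \<le> m' \<Longrightarrow> reach v m \<subseteq> reach v m'"
  by (rule lift_Suc_mono_le) (rule reach_Suc)

lemma image_reach_even:
  assumes "even m" "x \<in> reach v m"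
  shows "h x \<in> reach v (Suc m)"
proof -
  obtain W where W: "W \<in> \<P> m" "connected_to F (m, W) v" "x \<in> W"
    using assms(2) unfolding reach_def by blast
  then have "h x \<in> X"
    using cell_subset surj_on by blast
  then obtain W' where W': "W' \<in> \<P> (Suc m)" "h x \<in> W'"
    by (rule cell_exists)
  have "connected_to F (Suc m, W') v"
    using W W' assms(1) cell_subset_image connected_to_red by presburger
  then show ?thesis
    using W' unfolding reach_def by blast
qed

lemma vimage_reach_odd:
  assumes "odd m" "x \<in> X" "h x \<in> reach v m"
  shows "x \<in> reach v (Suc m)"
proof -
  obtain W where W: "W \<in> \<P> m" "connected_to F (m, W) v" "h x \<in> W"
    using assms(3) unfolding reach_def by blast
  obtain W' where W': "W' \<in> \<P> (Suc m)" "x \<in> W'"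
    using assms(2) by (rule cell_exists)
  have "connected_to F (Suc m, W') v"
    using W W' assms(1) cell_subset_vimage connected_to_red by presburger
  then show ?thesis
    using W' unfolding reach_def by blast
qed

lemma Union_reach_invariant:
  assumes "x \<in> X"
  shows "h x \<in> (\<Union>m. reach v m) \<longleftrightarrow> x \<in> (\<Union>m. reach v m)"
proof
  assume "h x \<in> (\<Union>m. reach v m)"
  then obtain m where m: "h x \<in> reach v m" by blast
  \<comment> \<open>Monotonicity allows a move to an odd level beyond \<open>m\<close>, where red
    edges encode the inverse of \<open>h\<close>; the other direction uses the even level
    \<open>2 * m\<close>.\<close>
  have "h x \<in> reach v (2 * m + 1)"
    using m reach_mono[of m "2 * m + 1" v] by auto
  then have "x \<in> reach v (Suc (2 * m + 1))"
    using assms by (intro vimage_reach_odd) auto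
  then show "x \<in> (\<Union>m. reach v m)" by blast
next
  assume "x \<in> (\<Union>m. reach v m)"
  then obtain m where m: "x \<in> reach v m" by blast
  have "x \<in> reach v (2 * m)"
    using m reach_mono[of m "2 * m" v] by auto
  then have "h x \<in> reach v (Suc (2 * m))"
    by (intro image_reach_even) auto
  then show "h x \<in> (\<Union>m. reach v m)" by blast
qed

section \<open>From minimality to connectedness\<close>

lemma minimal_imp_connected:
  assumes min: "minimal_system X h" and Z: "Z \<in> \<P> n"
  shows "\<exists>m. \<forall>w\<in>level F m. connected_to F w (n, Z)"
proof -
  define U where "U = (\<Union>m. reach (n, Z) m)"
  have "Z \<subseteq> reach (n, Z) n"
    unfolding reach_def using Z by (auto intro!: connected_to_refl simp: h_diagram_graph_def)
  then have ZU: "Z \<subseteq> U" unfolding U_def by blast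
  have ne: "X \<noteq> {}"
    using Z cell_subset cell_nonempty by blast
  have "closedin (top_of_set X) (X - U)"
    unfolding U_def using open_reach by (intro closedin_diff openin_Union) auto
  \<comment> \<open>The equivalence for points gives one inclusion directly; with surjectivity of
    \<open>h\<close> it also gives the other.\<close>
  moreover have "h ` (X - U) = X - U"
  proof -
    have "h x \<in> U \<longleftrightarrow> x \<in> U" if "x \<in> X" for x
      unfolding U_def using that by (rule Union_reach_invariant)
    then show ?thesis using surj_on by force
  qed
  moreover have "X - U \<noteq> X"
    using ZU Z cell_subset cell_nonempty by blast
  ultimately have "X - U = {}"
    using min minimal_system_iff[OF ne surj_on] by blast
  then have "X \<subseteq> U" by blast
  \<comment> \<open>Compactness is stated with open sets of the ambient space, so each relatively
    open \<open>reach\<close> set is extended to such a \<open>T m\<close>.\<close>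
  moreover obtain T where T: "\<And>m. open (T m)" "\<And>m. reach (n, Z) m = X \<inter> T m"
    using open_reach unfolding openin_open by metis
  ultimately have "X \<subseteq> (\<Union>m. T m)" unfolding U_def by blast
  then obtain M where M: "finite M" "X \<subseteq> (\<Union>m\<in>M. T m)"
    using compactE_image[OF compact, of UNIV T] T(1) by (metis subset_UNIV)
  \<comment> \<open>The sets increase with the level, so the largest index of the finite subcover
    already covers \<open>X\<close>.\<close>
  have X: "X \<subseteq> reach (n, Z) (Max M)"
  proof
    fix x assume x: "x \<in> X"
    then obtain m where "m \<in> M" "x \<in> T m"
      using M by blast
    then have "x \<in> reach (n, Z) m" "m \<le> Max M"
      using x T(2) M(1) by auto
    then show "x \<in> reach (n, Z) (Max M)"
      using reach_mono by blast
  qed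
  \<comment> \<open>A point of \<open>W\<close> lies in some connected cell of the same level, which
    is \<open>W\<close> itself by disjointness.\<close>
  have "connected_to F (Max M, W) (n, Z)" if W: "W \<in> \<P> (Max M)" for W
  proof -
    obtain x where x: "x \<in> W" using W cell_nonempty by blast
    then have "x \<in> reach (n, Z) (Max M)" using X W cell_subset by blast
    then show ?thesis
      using x W cell_unique unfolding reach_def by blast
  qed
  then show ?thesis
    by (intro exI[of _ "Max M"]) (auto simp: level_diagram)
qed

section \<open>From (EM) to minimality\<close>

lemma infinite_blue_path_exists:
  assumes "Z \<in> \<P> n"
  obtains \<gamma> where "infinite_blue_path F \<gamma>" "head F (\<gamma> 0) = (n, Z)"
proof -
  \<comment> \<open>The cells around one fixed point are nested, so from level \<open>n\<close> on
    they form a blue path. Hence every vertex is the range of some blue path, and (EM) says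
    something about each of them.\<close>
  obtain x where x: "x \<in> Z" using assms cell_nonempty by blast
  then have "\<forall>m. \<exists>C. C \<in> \<P> m \<and> x \<in> C"
    using assms cell_subset cell_exists by (metis subsetD)
  then obtain C where C: "\<And>m. C m \<in> \<P> m" "\<And>m. x \<in> C m" by metis
  let ?\<gamma> = "\<lambda>i. (Blue, (Suc (n + i), C (Suc (n + i))), (n + i, C (n + i)))"
  have "infinite_blue_path F ?\<gamma>"
    using C cell_subset_cell[OF C(1) C(1) C(2) C(2)]
    by (auto simp: infinite_blue_path_def infinite_path_def h_diagram_graph_def)
  moreover have "C n = Z"
    using C x assms cell_unique by blast
  ultimately show ?thesis
    by (intro that[of ?\<gamma>]) (simp_all add: h_diagram_graph_def)
qed

lemma arc_cases:
  assumes "e \<in> arcs F"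
  obtains n Z Z' where "head F e = (n, Z)" "tail F e = (Suc n, Z')" "Z \<in> \<P> n"
    "Z' \<subseteq> Z \<or> Z' \<subseteq> h ` Z \<or> Z' \<subseteq> h -` Z"
proof -
  consider n Z Z' where "e = (Blue, (Suc n, Z'), (n, Z))" "Z \<in> \<P> n" "Z' \<subseteq> Z"
    | n Z Z' where "e = (Red, (Suc n, Z'), (n, Z))" "Z \<in> \<P> n"
        "Z' \<subseteq> (if even n then h ` Z else X \<inter> h -` Z)"
    using assms unfolding h_diagram_graph_def pre_digraph.select_convs by blast
  then show ?thesis
  proof cases
    case 1
    then show ?thesis by (intro that[of n Z Z']) (simp_all add: h_diagram_graph_def)
  next
    case 2
    then show ?thesis
      by (intro that[of n Z Z']) (simp_all add: h_diagram_graph_def split: if_splits)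
  qed
qed

text \<open>The source of an edge lies in the range cell, in its image or in its preimage. A point
  of \<open>C\<close> in the source thus yields one in the range: the point itself, its preimage in
  \<open>C\<close>, or its image under \<open>h\<close>.\<close>

lemma arc_meets_invariant:
  assumes "e \<in> arcs F" "h ` C = C" "C \<subseteq> X" "snd (tail F e) \<inter> C \<noteq> {}"
  shows "snd (head F e) \<inter> C \<noteq> {}"
proof -
  have Z: "Z \<inter> C \<noteq> {}"
    if *: "Z \<in> \<P> n" "Z' \<subseteq> h ` Z" "x \<in> Z'" "x \<in> C" for n Z Z' x
  proof -
    obtain z where z: "z \<in> Z" "x = h z" using *(2,3) by blast
    obtain c where c: "c \<in> C" "x = h c" using *(4) assms(2) by blast
    have "z = c"
      using z c *(1) assms(3) cell_subset inj_on by (metis inj_onD subsetD)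
    with z c show ?thesis by blast
  qed
  obtain n W W' where e: "head F e = (n, W)" "tail F e = (Suc n, W')" "W \<in> \<P> n"
    "W' \<subseteq> W \<or> W' \<subseteq> h ` W \<or> W' \<subseteq> h -` W"
    using assms(1) by (rule arc_cases)
  then obtain x where x: "x \<in> W'" "x \<in> C"
    using assms(4) by auto
  from e(4) have "W \<inter> C \<noteq> {}"
  proof (elim disjE)
    assume "W' \<subseteq> h ` W"
    then show ?thesis using e(3) x by (intro Z)
  next
    assume "W' \<subseteq> h -` W"
    then show ?thesis using x assms(2) by blast
  qed (use x in blast)
  then show ?thesis using e(1) by simp
qed

lemma connected_imp_minimal:
  assumes conn: "\<And>n Z. Z \<in> \<P> n \<Longrightarrow> \<exists>m. \<forall>w\<in>level F m. connected_to F w (n, Z)"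
    and ne: "X \<noteq> {}"
  shows "minimal_system X h"
proof -
  have "C = X" if C: "closedin (top_of_set X) C" "C \<noteq> {}" "h ` C = C" for C
  proof (rule ccontr)
    assume "C \<noteq> X"
    have CX: "C \<subseteq> X" using C(1) closedin_imp_subset by blast
    have "openin (top_of_set X) (X - C)"
      using C(1) by (intro openin_diff) auto
    moreover have "topology_basis (top_of_set X) (\<Union>n. \<P> n)"
      using refined unfolding h_refined_def by blast
    ultimately obtain \<U> where "\<U> \<subseteq> (\<Union>n. \<P> n)" "\<Union>\<U> = X - C"
      unfolding topology_basis_def by metis
    moreover have "X - C \<noteq> {}" using CX \<open>C \<noteq> X\<close> by blast
    \<comment> \<open>The non-empty open complement of \<open>C\<close> is a union of cells, so it
      contains a whole cell. This cell will be shown to meet \<open>C\<close>.\<close>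
    ultimately obtain n Z where Z: "Z \<in> \<P> n" "Z \<subseteq> X - C" by blast
    obtain m where m: "\<And>W. W \<in> \<P> m \<Longrightarrow> connected_to F (m, W) (n, Z)"
      using conn[OF Z(1)] by (auto simp: level_diagram)
    obtain c where c: "c \<in> C" using C(2) by blast
    then obtain W where W: "W \<in> \<P> m" "c \<in> W"
      using CX cell_exists by (metis subsetD)
    \<comment> \<open>Meeting \<open>C\<close> passes along a path from the source
      \<open>(m, W)\<close>, which contains \<open>c\<close>, to the range
      \<open>(n, Z)\<close>.\<close>
    have "snd (n, Z) \<inter> C \<noteq> {}"
      by (rule connected_to_backward_invariant[where Q = "\<lambda>v. snd v \<inter> C \<noteq> {}", OF m[OF W(1)]])
        (use c W C(3) CX arc_meets_invariant in auto)
    then show False using Z by auto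
  qed
  then show ?thesis
    using minimal_system_iff[OF ne surj_on] by blast
qed

lemma minimal_iff_EM:
  assumes "X \<noteq> {}"
  shows "minimal_system X h \<longleftrightarrow> (\<forall>\<gamma>. infinite_blue_path F \<gamma> \<longrightarrow> property_EM F \<gamma>)"
proof
  assume min: "minimal_system X h"
  have "\<exists>m. \<forall>w\<in>level F m. connected_to F w (head F (\<gamma> i))" if "infinite_blue_path F \<gamma>" for \<gamma> i
  proof -
    have "\<gamma> i \<in> arcs F"
      using that unfolding infinite_blue_path_def infinite_path_def by blast
    then obtain n Z where "head F (\<gamma> i) = (n, Z)" "Z \<in> \<P> n"
      by (rule arc_cases)
    with minimal_imp_connected[OF min] show ?thesis by simp
  qed
  then show "\<forall>\<gamma>. infinite_blue_path F \<gamma> \<longrightarrow> property_EM F \<gamma>"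
    unfolding property_EM_def by blast
next
  assume EM: "\<forall>\<gamma>. infinite_blue_path F \<gamma> \<longrightarrow> property_EM F \<gamma>"
  have "\<exists>m. \<forall>w\<in>level F m. connected_to F w (n, Z)" if Z: "Z \<in> \<P> n" for n Z
  proof -
    obtain \<gamma> where \<gamma>: "infinite_blue_path F \<gamma>" "head F (\<gamma> 0) = (n, Z)"
      using Z by (rule infinite_blue_path_exists)
    then have "property_EM F \<gamma>" using EM by blast
    \<comment> \<open>Only the index \<open>i = 0\<close> of (EM) is taken, where the range is the
      prescribed vertex.\<close>
    then show ?thesis unfolding property_EM_def \<gamma>(2)[symmetric] by blast
  qed
  then show "minimal_system X h"
    using assms by (rule connected_imp_minimal)
qed

end

theorem corollary4p10:
  fixes X :: "'a::metric_space set"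
    and h :: "'a \<Rightarrow> 'a"
    and \<P> :: "nat \<Rightarrow> 'a set set"
    and F :: "('a diagram_vertex, 'a diagram_edge) colored_diagram"
    and D :: "'a diagram_vertex \<Rightarrow> 'a diagram_edge set set"
  assumes "X \<noteq> {}" and "compact X" and "totally_disconnected X"
    and "homeomorphic_map (top_of_set X) (top_of_set X) h"
    and "h_refined X h \<P>"
    and "(F, D) = h_diagram X h \<P>"
  shows "minimal_system X h \<longleftrightarrow> (\<forall>\<gamma>. infinite_blue_path F \<gamma> \<longrightarrow> property_EM F \<gamma>)"
proof -
  have "bij_betw h X X"
    using homeomorphic_imp_injective_map[OF assms(4)] homeomorphic_imp_surjective_map[OF assms(4)]
    by (simp add: bij_betw_def)
  then interpret refined_system X h \<P>
    using assms(2,5) by unfold_locales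
  show ?thesis
    using minimal_iff_EM[OF assms(1)] assms(6) unfolding h_diagram_def by blast
qed

end
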